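(* Let $n \ge 2$ and $m \ge 1$ be integers, and let $\{x_0, x_1, \ldots, x_m\}$ be a set of $m+1$ distinct points of the Hamming cube $H_n$ with $x_0 = \mathbf{0}$. If the vectors $x_1, x_2, \ldots, x_m$ are linearly dependent in $\mathbb{R}^n$, then $\det(D) = 0$. Consequently, \[ \det \begin{pmatrix} 0 & u^T \\ u & G \end{pmatrix} = 0. \]
   Context: $H_n$ is the set $\{0,1\}^n \subset \mathbb{R}^n$ with the metric $d(x,y) = \|x-y\|_1 = \sum_{k=1}^n |x_k - y_k|$. $\mathbf{0}$ is the zero vector of $\mathbb{R}^n$. $D = (d(x_i,x_j))_{i,j=0}^m$ is the $(m+1)\times(m+1)$ distance matrix. $G = (x_i \cdot x_j)_{i,j=1}^m$ is the $m \times m$ Gram matrix of $x_1,\ldots,x_m$. $u = (x_1\cdot x_1, \ldots, x_m \cdot x_m)^T \in \mathbb{R}^m$ is a column vector. The displayed block matrix is $(m+1)\times(m+1)$. *)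

theory Defs
  imports "Jordan_Normal_Form.VS_Connect"
begin

definition hamming_cube :: "nat \<Rightarrow> real vec set" where
  "hamming_cube n = {x \<in> carrier_vec n. \<forall>k<n. x $ k \<in> {0, 1}}"

definition l1_norm :: "real vec \<Rightarrow> real" where
  "l1_norm v = (\<Sum>k<dim_vec v. \<bar>v $ k\<bar>)"

definition l1_dist :: "real vec \<Rightarrow> real vec \<Rightarrow> real" where
  "l1_dist x y = l1_norm (x - y)"

definition distance_matrix :: "nat \<Rightarrow> (nat \<Rightarrow> real vec) \<Rightarrow> real mat" where
  "distance_matrix m x = mat (m + 1) (m + 1) (\<lambda>(i, j). l1_dist (x i) (x j))"

text \<open>Matrix indices start at 0, so index \<open>i\<close> in the two definitions below stands for the
  point \<open>x (i + 1)\<close>; the point \<open>x 0\<close> does not enter.\<close>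

definition gram_matrix :: "nat \<Rightarrow> (nat \<Rightarrow> real vec) \<Rightarrow> real mat" where
  "gram_matrix m x = mat m m (\<lambda>(i, j). x (i + 1) \<bullet> x (j + 1))"

definition sq_norm_column :: "nat \<Rightarrow> (nat \<Rightarrow> real vec) \<Rightarrow> real mat" where
  "sq_norm_column m x = mat m 1 (\<lambda>(i, _). x (i + 1) \<bullet> x (i + 1))"

definition bordered_gram_matrix :: "nat \<Rightarrow> (nat \<Rightarrow> real vec) \<Rightarrow> real mat" where
  "bordered_gram_matrix m x =
     four_block_mat (0\<^sub>m 1 1) (transpose_mat (sq_norm_column m x))
                    (sq_norm_column m x) (gram_matrix m x)"

text \<open>Linear dependence of a set of vectors in \<open>\<real>\<^sup>n\<close>, as provided by the vector space
  \<open>module_vec\<close>. For an injectively indexed family this is linear dependence of the family.\<close>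

abbreviation lin_dep_vec :: "nat \<Rightarrow> real vec set \<Rightarrow> bool" where
  "lin_dep_vec n S \<equiv> LinearCombinations.module.lin_dep class_ring (module_vec TYPE(real) n) S"

end

theory Submission
  imports Defs
begin

text \<open>On \<open>{0, 1}\<close> one has \<open>a\<^sup>2 = a\<close> and \<open>\<bar>a - b\<bar> = a + b - 2ab\<close>, so for points of the cube
  \<open>d(x, y) = x \<bullet> x + y \<bullet> y - 2(x \<bullet> y)\<close> and \<open>x \<bullet> x\<close> is the scalar product of \<open>x\<close> with the
  all-ones vector. A linear relation \<open>\<Sum>j. c\<^sub>j x\<^sub>j = 0\<close> therefore also yields
  \<open>\<Sum>j. c\<^sub>j (x\<^sub>j \<bullet> x\<^sub>j) = 0\<close>. Hence \<open>(0, c)\<close> lies in the kernel of the bordered Gram matrix, and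
  \<open>(- \<Sum>j. c\<^sub>j, c)\<close> in the kernel of the distance matrix.\<close>

lemma hamming_cube_scalar_prod_self:
  assumes "x \<in> hamming_cube n"
  shows "x \<bullet> x = (\<Sum>k<n. x $ k)"
proof -
  have "x $ k * x $ k = x $ k" if "k < n" for k
    using assms that by (auto simp: hamming_cube_def)
  then show ?thesis
    using assms by (auto simp: scalar_prod_def hamming_cube_def lessThan_atLeast0 intro!: sum.cong)
qed

lemma hamming_cube_l1_dist:
  assumes "x \<in> hamming_cube n" and "y \<in> hamming_cube n"
  shows "l1_dist x y = x \<bullet> x + y \<bullet> y - 2 * (x \<bullet> y)"
proof -
  have "dim_vec x = n" "dim_vec y = n"
    using assms by (auto simp: hamming_cube_def)
  then have "l1_dist x y = (\<Sum>k<n. \<bar>x $ k - y $ k\<bar>)"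
    by (simp add: l1_dist_def l1_norm_def)
  also have "\<dots> = (\<Sum>k<n. x $ k * x $ k + y $ k * y $ k - 2 * (x $ k * y $ k))"
  proof (rule sum.cong)
    fix k assume "k \<in> {..<n}"
    then have "x $ k \<in> {0, 1}" "y $ k \<in> {0, 1}"
      using assms by (auto simp: hamming_cube_def)
    then show "\<bar>x $ k - y $ k\<bar> = x $ k * x $ k + y $ k * y $ k - 2 * (x $ k * y $ k)"
      by auto
  qed simp
  also have "\<dots> = x \<bullet> x + y \<bullet> y - 2 * (x \<bullet> y)"
    using \<open>dim_vec x = n\<close> \<open>dim_vec y = n\<close>
    by (simp add: scalar_prod_def sum.distrib sum_subtractf sum_distrib_left lessThan_atLeast0)
  finally show ?thesis .
qed

text \<open>Passes from dependence of a set to a coordinatewise relation between indexed vectors.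
  Injectivity allows reindexing the sum over the image and so prevents a vector from being counted
  twice.\<close>

lemma lin_dep_vec_family:
  fixes x :: "'i \<Rightarrow> real vec"
  assumes "finite I" and "inj_on x I" and "x ` I \<subseteq> carrier_vec n"
    and "lin_dep_vec n (x ` I)"
  obtains c where "\<And>k. k < n \<Longrightarrow> (\<Sum>i\<in>I. c i * x i $ k) = 0" and "\<exists>i\<in>I. c i \<noteq> 0"
proof -
  interpret vec_space "TYPE(real)" n .
  obtain A a v where A: "finite A" "A \<subseteq> x ` I" "lincomb a A = 0\<^sub>v n" "v \<in> A" "a v \<noteq> 0"
    using assms(4) unfolding lin_dep_def by auto
  \<comment> \<open>The given relation involves only \<open>A\<close>, so its coefficients are
    extended by zero to the rest of the image.\<close>
  define c where "c i = (if x i \<in> A then a (x i) else 0)" for i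
  show ?thesis
  proof
    fix k assume "k < n"
    have "(\<Sum>i\<in>I. c i * x i $ k) = (\<Sum>y\<in>x ` I. (if y \<in> A then a y else 0) * y $ k)"
      using assms(2) by (simp add: sum.reindex c_def)
    also have "\<dots> = (\<Sum>y\<in>A. a y * y $ k)"
      using A(2) assms(1) by (intro sum.mono_neutral_cong_right) auto
    also have "\<dots> = lincomb a A $ k"
      using \<open>k < n\<close> A(2) assms(3) by (subst lincomb_index) auto
    finally show "(\<Sum>i\<in>I. c i * x i $ k) = 0"
      using A(3) \<open>k < n\<close> by simp
  next
    show "\<exists>i\<in>I. c i \<noteq> 0"
      using A by (auto simp: c_def)
  qed
qed

text \<open>The vector with entries \<open>c j\<close> is a nonzero kernel vector. Row sums are used
  so that column 0 can later be split off.\<close>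

lemma det_eq_0_if_kernel:
  fixes A :: "'a :: idom mat"
  assumes "A \<in> carrier_mat n n"
    and "\<And>i. i < n \<Longrightarrow> (\<Sum>j<n. A $$ (i, j) * c j) = 0"
    and "j < n" and "c j \<noteq> 0"
  shows "det A = 0"
proof -
  have "A *\<^sub>v vec n c = 0\<^sub>v n"
    using assms(1,2) by (intro eq_vecI) (auto simp: scalar_prod_def lessThan_atLeast0)
  moreover have "vec n c \<noteq> 0\<^sub>v n"
    using assms(3,4) by (metis index_vec index_zero_vec(1))
  ultimately show ?thesis
    using det_0_iff_vec_prod_zero[OF assms(1)] vec_carrier by blast
qed

theorem theorem2p2:
  fixes n m :: nat and x :: "nat \<Rightarrow> real vec"
  assumes "n \<ge> 2" and "m \<ge> 1"
    and "\<And>i. i \<le> m \<Longrightarrow> x i \<in> hamming_cube n"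
    and "inj_on x {0..m}"
    and "x 0 = 0\<^sub>v n"
    and "lin_dep_vec n (x ` {1..m})"
  shows "det (distance_matrix m x) = 0 \<and> det (bordered_gram_matrix m x) = 0"
proof -
  have cube: "x i \<in> hamming_cube n" if "i \<le> m" for i
    using assms(3) that .
  then have carrier: "x i \<in> carrier_vec n" if "i \<le> m" for i
    using that by (auto simp: hamming_cube_def)
  have "inj_on x {1..m}"
    using assms(4) by (rule inj_on_subset) auto
  moreover have "x ` {1..m} \<subseteq> carrier_vec n"
    using carrier by auto
  ultimately obtain c where rel: "\<And>k. k < n \<Longrightarrow> (\<Sum>i\<in>{1..m}. c i * x i $ k) = 0"
    and nz: "\<exists>i\<in>{1..m}. c i \<noteq> 0"
    using lin_dep_vec_family[OF _ _ _ assms(6)] by blast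
  obtain l where l: "1 \<le> l" "l \<le> m" "c l \<noteq> 0"
    using nz by auto
  \<comment> \<open>Any linear functional, with coefficients \<open>w\<close>, respects the
    relation. Taking \<open>w\<close> to be \<open>y\<close> gives \<open>gram\<close>; taking all
    ones gives \<open>sq\<close>.\<close>
  have weighted: "(\<Sum>j\<in>{1..m}. c j * (\<Sum>k<n. w k * x j $ k)) = 0" for w
  proof -
    have "(\<Sum>j\<in>{1..m}. c j * (\<Sum>k<n. w k * x j $ k))
        = (\<Sum>k<n. w k * (\<Sum>j\<in>{1..m}. c j * x j $ k))"
      unfolding sum_distrib_left by (subst sum.swap) (simp add: mult.left_commute)
    then show ?thesis
      using rel by simp
  qed
  have gram: "(\<Sum>j\<in>{1..m}. c j * (y \<bullet> x j)) = 0" for y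
  proof -
    have "y \<bullet> x j = (\<Sum>k<n. y $ k * x j $ k)" if "j \<le> m" for j
      using carrier[OF that] by (simp add: scalar_prod_def lessThan_atLeast0)
    then show ?thesis
      using weighted[of "\<lambda>k. y $ k"] by simp
  qed
  have sq: "(\<Sum>j\<in>{1..m}. c j * (x j \<bullet> x j)) = 0"
    using weighted[of "\<lambda>_. 1"] hamming_cube_scalar_prod_self[OF cube] by simp
  have split: "(\<Sum>j<Suc m. f j) = f 0 + (\<Sum>j\<in>{1..m}. f j)" for f :: "nat \<Rightarrow> real"
    by (simp add: sum.lessThan_Suc_shift sum.atLeast1_atMost_eq del: sum.lessThan_Suc)
  have "det (distance_matrix m x) = 0"
  proof (rule det_eq_0_if_kernel)
    show "distance_matrix m x \<in> carrier_mat (Suc m) (Suc m)"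
      by (simp add: distance_matrix_def)
    \<comment> \<open>Since \<open>1 \<le> l\<close>, overwriting entry 0 leaves \<open>c l\<close>
      intact.\<close>
    show "l < Suc m" "(c(0 := - (\<Sum>j\<in>{1..m}. c j))) l \<noteq> 0"
      using l by auto
    fix i assume i: "i < Suc m"
    have "(\<Sum>j\<in>{1..m}. l1_dist (x i) (x j) * c j)
        = (\<Sum>j\<in>{1..m}. (x i \<bullet> x i) * c j + c j * (x j \<bullet> x j) - 2 * (c j * (x i \<bullet> x j)))"
      using i by (intro sum.cong) (auto simp: hamming_cube_l1_dist[OF cube cube] algebra_simps)
    also have "\<dots> = (x i \<bullet> x i) * (\<Sum>j\<in>{1..m}. c j)"
      unfolding sum_subtractf sum.distrib sum_distrib_left[symmetric] gram sq by simp
    \<comment> \<open>As \<open>x 0\<close> is the origin, column 0 contributes the same factor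
      \<open>x i \<bullet> x i\<close>, and the chosen entry 0 cancels the remaining sum.\<close>
    moreover have "l1_dist (x i) (x 0) = x i \<bullet> x i"
      using i carrier[of i] hamming_cube_l1_dist[OF cube cube, of i 0] by (simp add: assms(5))
    ultimately show "(\<Sum>j<Suc m. distance_matrix m x $$ (i, j) * (c(0 := - (\<Sum>j\<in>{1..m}. c j))) j) = 0"
      using i unfolding split by (simp add: distance_matrix_def)
  qed
  moreover have "det (bordered_gram_matrix m x) = 0"
  proof (rule det_eq_0_if_kernel)
    show "bordered_gram_matrix m x \<in> carrier_mat (Suc m) (Suc m)"
      by (intro carrier_matI) (simp_all add: bordered_gram_matrix_def gram_matrix_def sq_norm_column_def)
    show "l < Suc m" "(c(0 := 0)) l \<noteq> 0"
      using l by auto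
    fix i assume i: "i < Suc m"
    \<comment> \<open>The border of width 1 offsets the shift by one in the Gram matrix, so column
      \<open>j\<close> belongs to \<open>x j\<close>. Row 0 then vanishes by \<open>sq\<close>, the
      other rows by \<open>gram\<close>.\<close>
    have entry: "bordered_gram_matrix m x $$ (i, j) = (if i = 0 then x j \<bullet> x j else x i \<bullet> x j)"
      if "j \<in> {1..m}" for j
      using i that
      by (auto simp: bordered_gram_matrix_def gram_matrix_def sq_norm_column_def)
    have "(\<Sum>j\<in>{1..m}. bordered_gram_matrix m x $$ (i, j) * (c(0 := 0)) j)
        = (\<Sum>j\<in>{1..m}. c j * (if i = 0 then x j \<bullet> x j else x i \<bullet> x j))"
      by (intro sum.cong) (auto simp: entry)
    also have "\<dots> = 0"
      using gram[of "x i"] sq by (cases "i = 0") simp_all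
    finally show "(\<Sum>j<Suc m. bordered_gram_matrix m x $$ (i, j) * (c(0 := 0)) j) = 0"
      unfolding split by simp
  qed
  ultimately show ?thesis ..
qed

end
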